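(* Let $c\in(0,1)$ and let $n$ be a positive integer. Then for every sufficiently large prime $p$ (in terms of $c$ and $n$), a uniformly random set $B$ of $n+2$ points in $\mathbb{F}_p^n$ satisfies \[ \underbrace{B+\cdots+B}_{\lceil cp\rceil\text{ times}}=\mathbb{F}_p^n \] with probability $1-o_p(1)$, i.e. with probability tending to $1$ as $p\to\infty$ (with $c,n$ fixed).
   Context: For sets $A,B$ in an abelian group, $A+B=\{a+b: a\in A, b\in B\}$; iterated sumsets are defined analogously. *)

theory Defs
  imports
    "HOL-Algebra.Product_Groups"
    "HOL-Number_Theory.Residues"
    "HOL-Probability.Probability_Mass_Function"
begin

text \<open>
  The additive group of \<open>\<F>\<^sub>p\<^sup>n\<close>. A vector is a function on \<open>{..<n}\<close> (extensional outside it)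
  with values in \<open>{0..p - 1}\<close>. Groups are written multiplicatively, so
  \<open>\<otimes>\<close> is coordinatewise addition modulo \<open>p\<close> and \<open>A <#> B\<close> is the sumset \<open>A + B\<close>.
\<close>

definition Fp_space :: "nat \<Rightarrow> nat \<Rightarrow> (nat \<Rightarrow> int) monoid" where
  "Fp_space p n = product_group {..<n} (\<lambda>_. add_monoid (residue_ring (int p)))"

primrec iterated_sumset :: "('a, 'b) monoid_scheme \<Rightarrow> nat \<Rightarrow> 'a set \<Rightarrow> 'a set" where
  "iterated_sumset G 0 B = {\<one>\<^bsub>G\<^esub>}"
| "iterated_sumset G (Suc k) B = iterated_sumset G k B <#>\<^bsub>G\<^esub> B"

text \<open>
  The law of a uniformly random set of \<open>m\<close> distinct points of \<open>\<F>\<^sub>p\<^sup>n\<close>. It is only meaningful when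
  \<open>m \<le> p ^ n\<close>, since \<^const>\<open>pmf_of_set\<close> is unspecified on the empty set.
\<close>

definition random_point_set :: "nat \<Rightarrow> nat \<Rightarrow> nat \<Rightarrow> (nat \<Rightarrow> int) set pmf" where
  "random_point_set p n m = pmf_of_set {B. B \<subseteq> carrier (Fp_space p n) \<and> card B = m}"

end

theory Submission
  imports Defs
begin

text \<open>
  Write \<open>B = {b, b + d\<^sub>1, \<dots>, b + d\<^sub>n, b + w}\<close>. With probability at least \<open>1 - n / p\<close> the \<open>d\<^sub>i\<close> form a
  basis; in this basis \<open>w\<close> has uniformly distributed coordinates \<open>v\<close>. Then \<open>k B\<close> is everything as soon as
  each \<open>y\<close> can be written as \<open>x + t v\<close> modulo \<open>p\<close> with non-negative integers satisfying
  \<open>t + \<Sum>x\<^sub>i \<le> k\<close>. It suffices to look at \<open>t = m\<^sup>j\<close> for \<open>j < s\<close>, with \<open>m\<close> and \<open>s\<close> fixed and \<open>m\<close> at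
  least \<open>4 n / c\<close>: the box of side \<open>p / m\<close> containing \<open>m\<^sup>j v\<close> is given by the base \<open>m\<close> digits of
  the \<open>v\<^sub>i / p\<close> at position \<open>j\<close>, and these are almost independent for different \<open>j\<close>. Hence
  the probability that some box is missed is \<open>O(m\<^sup>n (1 - m\<^sup>-\<^sup>n)\<^sup>s)\<close>, which is small for large \<open>s\<close>.
  Passing from tuples \<open>(b, d, w)\<close> to sets \<open>B\<close> costs only a constant factor.
\<close>

section \<open>Short representations from base \<open>m\<close> digits\<close>

text \<open>
  When \<open>B = {0, e\<^sub>1, \<dots>, e\<^sub>n, v}\<close>, this says that every \<open>y\<close> is a sum of \<open>k\<close> elements
  of \<open>B\<close>: \<open>t\<close> copies of \<open>v\<close>, \<open>x i\<close> copies of the \<open>i\<close>-th basis vector, and zeros.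
\<close>

definition short_cover :: "nat \<Rightarrow> nat \<Rightarrow> nat \<Rightarrow> (nat \<Rightarrow> nat) \<Rightarrow> bool" where
  "short_cover p n k v \<longleftrightarrow>
     (\<forall>y \<in> {..<n} \<rightarrow>\<^sub>E {..<p}. \<exists>t x. t + sum x {..<n} \<le> k \<and> (\<forall>i<n. [x i + t * v i = y i] (mod p)))"

text \<open>The base \<open>m\<close> digit number \<open>j\<close> after the point of \<open>u / p\<close>.\<close>

definition digit :: "nat \<Rightarrow> nat \<Rightarrow> nat \<Rightarrow> nat \<Rightarrow> nat" where
  "digit m p j u = m * (m ^ j * u mod p) div p"

lemma digit_less:
  assumes "0 < p" and "0 < m"
  shows "digit m p j u < m"
proof -
  have "m * (m ^ j * u mod p) < m * p" using assms by simp
  then show ?thesis unfolding digit_def using assms by (simp add: div_less_iff_less_mult)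
qed

text \<open>One step of long division of \<open>u\<close> by \<open>p\<close> in base
  \<open>m\<close>: appending a digit to the prefix \<open>m ^ j * u div p\<close>.\<close>

lemma power_Suc_mult_div_eq_digit:
  assumes "0 < p"
  shows "m ^ Suc j * u div p = m * (m ^ j * u div p) + digit m p j u"
proof -
  define a where "a = m ^ j * u"
  have "m ^ Suc j * u = m * (p * (a div p) + a mod p)"
    unfolding a_def by (simp only: mult_div_mod_eq power_Suc mult.assoc)
  also have "\<dots> = p * (m * (a div p)) + m * (a mod p)"
    by (simp only: distrib_left mult.left_commute)
  finally show ?thesis using assms by (simp add: digit_def a_def)
qed

text \<open>Because \<open>u < p\<close>, the empty prefix is 0, so the first \<open>s\<close>
  digits rebuild the whole prefix.\<close>

lemma div_eq_of_digits_eq: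
  assumes "0 < p" and "u < p" and "u' < p" and "\<forall>j<s. digit m p j u = digit m p j u'"
  shows "m ^ s * u div p = m ^ s * u' div p"
  using assms(4)
proof (induction s)
  case (Suc s)
  then show ?case using assms(1) by (simp add: power_Suc_mult_div_eq_digit del: power_Suc)
qed (use assms in simp)

text \<open>Fixing \<open>s\<close> digits confines \<open>u / p\<close> to an interval of length
  \<open>1 / m^s\<close>, hence \<open>u\<close> to a window of length \<open>p / m^s\<close>. The
  \<open>+ 1\<close> counts both ends of the window.\<close>

lemma card_digits_eq_le:
  assumes p: "0 < p" and m: "0 < m"
  shows "card {u \<in> {..<p}. \<forall>j<s. digit m p j u = D j} \<le> p div m ^ s + 1"
proof (cases "{u \<in> {..<p}. \<forall>j<s. digit m p j u = D j} = {}")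
  case False
  define S where "S = {u \<in> {..<p}. \<forall>j<s. digit m p j u = D j}"
  have fin: "finite S" unfolding S_def by simp
  define u0 where "u0 = Min S"
  have u0: "u0 \<in> S" using False fin unfolding u0_def S_def[symmetric] by simp
  have "S \<subseteq> {u0 .. u0 + p div m ^ s}"
  proof
    fix u assume u: "u \<in> S"
    have le: "u0 \<le> u" using fin u unfolding u0_def by simp
    have "m ^ s * u div p = m ^ s * u0 div p"
      using u u0 p unfolding S_def by (intro div_eq_of_digits_eq) auto
    \<comment> \<open>Numbers with the same quotient by \<open>p\<close> differ by less than
      \<open>p\<close>.\<close>
    then have "m ^ s * u < m ^ s * u0 + p"
      using dividend_less_div_times[OF p, of "m ^ s * u"] div_times_less_eq_dividend[of "m ^ s * u0" p]
      by (metis add.commute add_le_cancel_left less_le_trans)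
    then have "m ^ s * (u - u0) \<le> p" using le by (simp add: diff_mult_distrib2)
    then have "u - u0 \<le> p div m ^ s" using m by (simp add: less_eq_div_iff_mult_less_eq mult.commute)
    then show "u \<in> {u0 .. u0 + p div m ^ s}" using le by auto
  qed
  then have "card S \<le> card {u0 .. u0 + p div m ^ s}" by (intro card_mono) auto
  then show ?thesis unfolding S_def by simp
next
  case True
  then show ?thesis by (simp only: card.empty le0)
qed

text \<open>Sort the vectors by their full table \<open>D\<close> of \<open>s\<close> digit vectors.
  Avoiding \<open>e\<close> leaves \<open>m^n - 1\<close> choices for each row; once the table is
  fixed, the coordinates vary independently, each in a short window. This is the near independence
  of the digit positions.\<close>

lemma card_digit_vector_avoiding_le:
  assumes p: "0 < p" and m: "0 < m" and e: "e \<in> {..<n} \<rightarrow>\<^sub>E {..<m}"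
  shows "card {v \<in> {..<n} \<rightarrow>\<^sub>E {..<p}. \<forall>j<s. \<exists>i<n. digit m p j (v i) \<noteq> e i}
    \<le> (m ^ n - 1) ^ s * (p div m ^ s + 1) ^ n"
proof -
  define A where "A = {v \<in> {..<n} \<rightarrow>\<^sub>E {..<p}. \<forall>j<s. \<exists>i<n. digit m p j (v i) \<noteq> e i}"
  define T where "T = {..<s} \<rightarrow>\<^sub>E (({..<n} \<rightarrow>\<^sub>E {..<m}) - {e})"
  define F where "F D = (\<Pi>\<^sub>E i\<in>{..<n}. {u \<in> {..<p}. \<forall>j<s. digit m p j u = D j i})" for D :: "nat \<Rightarrow> nat \<Rightarrow> nat"
  have finT: "finite T" unfolding T_def by (intro finite_PiE) (auto intro!: finite_PiE)
  have "A \<subseteq> (\<Union>D\<in>T. F D)"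
  proof
    fix v assume v: "v \<in> A"
    define D where "D = (\<lambda>j\<in>{..<s}. \<lambda>i\<in>{..<n}. digit m p j (v i))"
    have "D \<in> T" unfolding T_def
    proof (rule PiE_I)
      fix j assume j: "j \<in> {..<s}"
      then obtain i where "i < n" "digit m p j (v i) \<noteq> e i" using v unfolding A_def by auto
      then have "D j \<noteq> e" using j unfolding D_def by auto
      moreover have "D j \<in> {..<n} \<rightarrow>\<^sub>E {..<m}"
        using j digit_less[OF p m] unfolding D_def by auto
      ultimately show "D j \<in> ({..<n} \<rightarrow>\<^sub>E {..<m}) - {e}" by blast
    qed (simp add: D_def)
    moreover have "v \<in> F D" using v unfolding F_def A_def D_def by (auto simp: PiE_iff)
    ultimately show "v \<in> (\<Union>D\<in>T. F D)" by blast
  qed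
  moreover have finF: "finite (F D)" for D unfolding F_def by (intro finite_PiE) auto
  ultimately have "card A \<le> card (\<Union>D\<in>T. F D)" using finT by (intro card_mono) auto
  also have "\<dots> \<le> (\<Sum>D\<in>T. card (F D))" using finT by (rule card_UN_le)
  also have "\<dots> \<le> (\<Sum>D\<in>T. (p div m ^ s + 1) ^ n)"
  proof (rule sum_mono)
    fix D
    have "card (F D) = (\<Prod>i<n. card {u \<in> {..<p}. \<forall>j<s. digit m p j u = D j i})"
      unfolding F_def by (simp add: card_PiE)
    also have "\<dots> \<le> (\<Prod>i<n. p div m ^ s + 1)"
      by (intro prod_mono) (use card_digits_eq_le[OF p m] in auto)
    finally show "card (F D) \<le> (p div m ^ s + 1) ^ n" by simp
  qed
  also have "card T = (m ^ n - 1) ^ s"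
    unfolding T_def using e by (simp add: card_PiE card_Diff_singleton)
  then have "(\<Sum>D\<in>T. (p div m ^ s + 1) ^ n) = (m ^ n - 1) ^ s * (p div m ^ s + 1) ^ n" by simp
  finally show ?thesis unfolding A_def .
qed

text \<open>
  If the digit of \<open>v\<close> at \<open>j\<close> is, cyclically, one less than the leading digit of \<open>y\<close>,
  then \<open>m\<^sup>j v\<close> lies behind \<open>y\<close> by at most \<open>2 p / m\<close>.
\<close>

lemma short_step_to_target:
  assumes p: "0 < p" and m: "0 < m" and y: "y < p"
    and e: "digit m p j v = (m * y div p + m - 1) mod m"
  shows "\<exists>x. m * x < 2 * p \<and> [x + m ^ j * v = y] (mod p)"
proof -
  define u where "u = m ^ j * v mod p"
  define f where "f = m * y div p"
  have f: "f * p \<le> m * y" "m * y < f * p + p"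
    using dividend_less_div_times[OF p, of "m * y"] by (simp_all add: f_def)
  have u: "digit m p j v * p \<le> m * u" "m * u < digit m p j v * p + p"
    using dividend_less_div_times[OF p, of "m * u"] by (simp_all add: digit_def u_def)
  have up: "u < p" using p unfolding u_def by simp
  have fm: "f < m" unfolding f_def using p m y by (simp add: div_less_iff_less_mult)
  have uv: "[x + m ^ j * v = y] (mod p)" if "(x + u) mod p = y" for x
    using that unfolding u_def unique_euclidean_semiring_class.cong_def
    by (metis mod_add_right_eq mod_mod_trivial)
  show ?thesis
  proof (cases "f = 0")
    \<comment> \<open>Wrap-around case: the digit is \<open>m - 1\<close>, so \<open>u\<close> lies
      in the last box and \<open>y\<close> in the first. The step from \<open>u\<close> to
      \<open>y\<close> passes through \<open>p\<close>.\<close>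
    case True
    have "(m - 1) mod m = m - 1" using m by simp
    then have "digit m p j v = m - 1" using e True unfolding f_def by simp
    then have "(m - 1) * p \<le> m * u" using u by simp
    then have "m * p \<le> m * u + p" using m by (simp add: algebra_simps)
    moreover have "m * (y + p - u) = m * y + m * p - m * u"
      by (simp add: diff_mult_distrib2 add_mult_distrib2)
    ultimately have "m * (y + p - u) < 2 * p" using f True p by simp
    moreover have "(y + p - u + u) mod p = y" using up y by simp
    ultimately show ?thesis using uv by blast
  next
    \<comment> \<open>Here the digit is \<open>f - 1\<close>, so \<open>u\<close> lies in the box
      just before that of \<open>y\<close> and no wrap-around occurs.\<close>
    case False
    then obtain g where g: "f = Suc g" using not0_implies_Suc by blast
    have "f + m - 1 = g + m" using g by simp
    then have "(f + m - 1) mod m = g" using fm g by (simp only: mod_add_self2) simp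
    then have d: "digit m p j v = g" using e unfolding f_def by simp
    have "m * u < g * p + p" using u(2) unfolding d .
    also have "\<dots> = f * p" unfolding g by simp
    also have "\<dots> \<le> m * y" by (rule f(1))
    finally have "m * u < m * y" .
    then have "u < y" by (simp only: mult_less_cancel1)
    have "m * y - m * u < 2 * p" using u(1) f(2) p unfolding d g by simp
    then have "m * (y - u) < 2 * p" by (simp only: diff_mult_distrib2)
    moreover have "(y - u + u) mod p = y" using \<open>u < y\<close> y by simp
    ultimately show ?thesis using uv by blast
  qed
qed

text \<open>The bound on \<open>k\<close> is the budget multiplied by \<open>m\<close>: the multiple
  \<open>t = m^j\<close> costs at most \<open>m^s\<close>, and each of the \<open>n\<close>
  coordinates needs a correction below \<open>2 p / m\<close>.\<close>

lemma short_cover_if_digits: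
  assumes p: "0 < p" and m: "0 < m"
    and k: "m ^ Suc s + 2 * n * p \<le> m * k"
    and v: "\<forall>e \<in> {..<n} \<rightarrow>\<^sub>E {..<m}. \<exists>j<s. \<forall>i<n. digit m p j (v i) = e i"
  shows "short_cover p n k v"
  unfolding short_cover_def
proof
  fix y assume y: "y \<in> {..<n} \<rightarrow>\<^sub>E {..<p}"
  \<comment> \<open>The box cyclically preceding that of \<open>y\<close>. Adding \<open>m\<close>
    before subtracting 1 sends leading digit 0 to \<open>m - 1\<close> on the naturals.\<close>
  define e where "e = (\<lambda>i\<in>{..<n}. (m * y i div p + m - 1) mod m)"
  have "e \<in> {..<n} \<rightarrow>\<^sub>E {..<m}" using m unfolding e_def by auto
  then obtain j where j: "j < s" "\<forall>i<n. digit m p j (v i) = e i" using v by blast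
  have "\<exists>x. m * x < 2 * p \<and> [x + m ^ j * v i = y i] (mod p)" if "i < n" for i
    using that j y by (intro short_step_to_target[OF p m]) (auto simp: e_def)
  then obtain x where x: "m * x i < 2 * p" "[x i + m ^ j * v i = y i] (mod p)" if "i < n" for i
    by metis
  have "m * (m ^ j + sum x {..<n}) = m ^ Suc j + (\<Sum>i<n. m * x i)"
    by (simp add: algebra_simps sum_distrib_left)
  also have "\<dots> \<le> m ^ Suc s + (\<Sum>i<n. 2 * p)"
    using j m x by (intro add_mono power_increasing sum_mono) (auto intro: less_imp_le)
  also have "\<dots> \<le> m * k" using k by (simp add: algebra_simps)
  finally have "m ^ j + sum x {..<n} \<le> k" using m by simp
  then show "\<exists>t x. t + sum x {..<n} \<le> k \<and> (\<forall>i<n. [x i + t * v i = y i] (mod p))"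
    using x by blast
qed

lemma card_not_short_cover_le:
  assumes p: "0 < p" and m: "0 < m"
    and k: "m ^ Suc s + 2 * n * p \<le> m * k"
  shows "card {v \<in> {..<n} \<rightarrow>\<^sub>E {..<p}. \<not> short_cover p n k v}
    \<le> m ^ n * ((m ^ n - 1) ^ s * (p div m ^ s + 1) ^ n)"
proof -
  define A where "A e = {v \<in> {..<n} \<rightarrow>\<^sub>E {..<p}. \<forall>j<s. \<exists>i<n. digit m p j (v i) \<noteq> e i}" for e
  define E where "E = {..<n} \<rightarrow>\<^sub>E {..<m}"
  have finE: "finite E" unfolding E_def by (intro finite_PiE) auto
  have "{v \<in> {..<n} \<rightarrow>\<^sub>E {..<p}. \<not> short_cover p n k v} \<subseteq> (\<Union>e\<in>E. A e)"
  proof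
    fix v assume v: "v \<in> {v \<in> {..<n} \<rightarrow>\<^sub>E {..<p}. \<not> short_cover p n k v}"
    then have "\<not> (\<forall>e\<in>E. \<exists>j<s. \<forall>i<n. digit m p j (v i) = e i)"
      using short_cover_if_digits[OF p m k, of v] unfolding E_def by auto
    then obtain e where "e \<in> E" "\<forall>j<s. \<exists>i<n. digit m p j (v i) \<noteq> e i" by auto
    then show "v \<in> (\<Union>e\<in>E. A e)" using v unfolding A_def by auto
  qed
  moreover have "finite (A e)" for e
    unfolding A_def by (rule finite_subset[of _ "{..<n} \<rightarrow>\<^sub>E {..<p}"]) (auto intro: finite_PiE)
  ultimately have "card {v \<in> {..<n} \<rightarrow>\<^sub>E {..<p}. \<not> short_cover p n k v} \<le> card (\<Union>e\<in>E. A e)"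
    using finE by (intro card_mono) auto
  also have "\<dots> \<le> (\<Sum>e\<in>E. card (A e))" using finE by (rule card_UN_le)
  also have "\<dots> \<le> (\<Sum>e\<in>E. (m ^ n - 1) ^ s * (p div m ^ s + 1) ^ n)"
    unfolding A_def E_def by (intro sum_mono card_digit_vector_avoiding_le p m)
  also have "\<dots> = m ^ n * ((m ^ n - 1) ^ s * (p div m ^ s + 1) ^ n)"
    by (simp add: E_def card_PiE)
  finally show ?thesis .
qed

section \<open>Sumsets in groups of prime exponent\<close>

context comm_group begin

lemma iterated_sumset_subset_carrier:
  assumes "B \<subseteq> carrier G"
  shows "iterated_sumset G k B \<subseteq> carrier G"
proof (induction k)
  case (Suc k)
  then show ?case using assms by (auto simp: set_mult_def)
qed simp

lemma iterated_sumset_mult: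
  assumes B: "B \<subseteq> carrier G" and x: "x \<in> iterated_sumset G j B" and y: "y \<in> iterated_sumset G k B"
  shows "x \<otimes> y \<in> iterated_sumset G (j + k) B"
  using y
proof (induction k arbitrary: y)
  case 0
  then show ?case using x iterated_sumset_subset_carrier[OF B, of j] by auto
next
  case (Suc k)
  then obtain y' b where y': "y' \<in> iterated_sumset G k B" "b \<in> B" "y = y' \<otimes> b"
    by (auto simp: set_mult_def)
  have "x \<otimes> y = (x \<otimes> y') \<otimes> b"
    using x y' B iterated_sumset_subset_carrier[OF B] by (simp add: m_assoc subset_iff)
  then show ?case using Suc.IH[OF y'(1)] y'(2) by (auto simp: set_mult_def)
qed

lemma iterated_sumset_pow:
  assumes B: "B \<subseteq> carrier G" and "b \<in> B"
  shows "b [^] (k::nat) \<in> iterated_sumset G k B"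
proof (induction k)
  case (Suc k)
  then show ?case using assms by (auto simp: set_mult_def)
qed simp

lemma iterated_sumset_finprod:
  assumes B: "B \<subseteq> carrier G" and "finite I" and "\<And>i. i \<in> I \<Longrightarrow> b i \<in> B"
  shows "(\<Otimes>i\<in>I. b i [^] (x i :: nat)) \<in> iterated_sumset G (sum x I) B"
  using assms(2,3)
proof (induction I rule: finite_induct)
  case (insert i I)
  have "(\<lambda>i. b i [^] (x i :: nat)) \<in> insert i I \<rightarrow> carrier G"
    using insert.prems B by auto
  then have "(\<Otimes>i\<in>insert i I. b i [^] x i) = b i [^] x i \<otimes> (\<Otimes>i\<in>I. b i [^] x i)"
    using insert.hyps by (simp add: Pi_iff)
  then show ?case
    using insert iterated_sumset_mult[OF B iterated_sumset_pow[OF B]] by simp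
qed simp

lemma finprod_pow_sum:
  assumes "finite I" and "a \<in> carrier G"
  shows "(\<Otimes>i\<in>I. a [^] (x i :: nat)) = a [^] sum x I"
  using assms by (induction I rule: finite_induct) (auto simp: nat_pow_mult)

lemma finprod_pow_distrib:
  assumes "finite I" and "d \<in> I \<rightarrow> carrier G"
  shows "(\<Otimes>i\<in>I. d i) [^] (t :: nat) = (\<Otimes>i\<in>I. d i [^] t)"
  using assms by (induction I rule: finite_induct) (auto simp: nat_pow_distrib Pi_iff)

lemma pow_cong_exponent:
  assumes "a \<in> carrier G" and "a [^] (p :: nat) = \<one>" and "[x = y] (mod p)"
  shows "a [^] x = a [^] y"
proof -
  have mod: "a [^] z = a [^] (z mod p)" for z :: nat
  proof -
    have "a [^] z = a [^] (p * (z div p) + z mod p)" by simp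
    also have "\<dots> = a [^] (p * (z div p)) \<otimes> a [^] (z mod p)"
      using assms(1) by (simp only: nat_pow_mult)
    also have "a [^] (p * (z div p)) = \<one>"
      using assms(1,2) by (simp only: nat_pow_pow[symmetric] nat_pow_one)
    finally show ?thesis using assms(1) by simp
  qed
  show ?thesis using assms(3) unfolding unique_euclidean_semiring_class.cong_def by (subst (1 2) mod) simp
qed

section \<open>Linear combinations and covering by sumsets\<close>

text \<open>Coefficients are naturals rather than residues because they will count how often an
  element is used as a summand.\<close>

definition lin_comb :: "nat \<Rightarrow> (nat \<Rightarrow> 'a) \<Rightarrow> (nat \<Rightarrow> nat) \<Rightarrow> 'a" where
  "lin_comb n d y = (\<Otimes>i\<in>{..<n}. d i [^] y i)"

lemma lin_comb_closed:
  assumes "d \<in> {..<n} \<rightarrow> carrier G"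
  shows "lin_comb n d y \<in> carrier G"
  unfolding lin_comb_def using assms by (intro finprod_closed) auto

lemma lin_comb_add:
  assumes "d \<in> {..<n} \<rightarrow> carrier G"
  shows "lin_comb n d (\<lambda>i. x i + y i) = lin_comb n d x \<otimes> lin_comb n d y"
proof -
  have "lin_comb n d (\<lambda>i. x i + y i) = (\<Otimes>i\<in>{..<n}. d i [^] x i \<otimes> d i [^] y i)"
    unfolding lin_comb_def using assms by (intro finprod_cong) (auto simp: nat_pow_mult simp_implies_def Pi_iff)
  then show ?thesis using assms unfolding lin_comb_def by (simp add: finprod_multf Pi_iff)
qed

lemma lin_comb_pow:
  assumes "d \<in> {..<n} \<rightarrow> carrier G"
  shows "lin_comb n d y [^] (t :: nat) = lin_comb n d (\<lambda>i. t * y i)"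
proof -
  have "lin_comb n d y [^] t = (\<Otimes>i\<in>{..<n}. (d i [^] y i) [^] t)"
    unfolding lin_comb_def using assms by (intro finprod_pow_distrib) auto
  also have "\<dots> = lin_comb n d (\<lambda>i. t * y i)"
    unfolding lin_comb_def using assms
    by (intro finprod_cong) (auto simp: nat_pow_pow simp_implies_def Pi_iff mult.commute)
  finally show ?thesis .
qed

lemma lin_comb_cong:
  assumes "d \<in> {..<n} \<rightarrow> carrier G" and "\<And>g. g \<in> carrier G \<Longrightarrow> g [^] (p :: nat) = \<one>"
    and "\<And>i. i < n \<Longrightarrow> [x i = y i] (mod p)"
  shows "lin_comb n d x = lin_comb n d y"
  unfolding lin_comb_def using assms
  by (intro finprod_cong) (auto simp: simp_implies_def Pi_iff intro!: pow_cong_exponent[where p=p])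

text \<open>Every element of the set is \<open>b\<close> plus one of 0, \<open>d i\<close> or the
  combination given by \<open>v\<close>. So, in additive terms, sums of \<open>k\<close> elements
  are \<open>k b\<close> plus sums of at most \<open>k\<close> of the differences, with copies of
  \<open>b\<close> as padding.\<close>

lemma iterated_sumset_eq_carrier:
  assumes exp: "\<And>g. g \<in> carrier G \<Longrightarrow> g [^] (p :: nat) = \<one>"
    and b: "b \<in> carrier G" and d: "d \<in> {..<n} \<rightarrow> carrier G"
    and surj: "lin_comb n d ` ({..<n} \<rightarrow>\<^sub>E {..<p}) = carrier G"
    and v: "short_cover p n k v"
  shows "iterated_sumset G k (insert b (insert (b \<otimes> lin_comb n d v) ((\<lambda>i. b \<otimes> d i) ` {..<n}))) = carrier G"
    (is "iterated_sumset G k ?B = _")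
proof
  have w: "lin_comb n d v \<in> carrier G" using d by (rule lin_comb_closed)
  have B: "?B \<subseteq> carrier G" using b d w by auto
  show "iterated_sumset G k ?B \<subseteq> carrier G" by (rule iterated_sumset_subset_carrier[OF B])
  show "carrier G \<subseteq> iterated_sumset G k ?B"
  proof
    fix z assume z: "z \<in> carrier G"
    \<comment> \<open>Each of the \<open>k\<close> summands will contribute one \<open>b\<close>, so
      \<open>k b\<close> is subtracted from the target first.\<close>
    then have "inv (b [^] k) \<otimes> z \<in> lin_comb n d ` ({..<n} \<rightarrow>\<^sub>E {..<p})" using b surj by simp
    then obtain y where y: "y \<in> {..<n} \<rightarrow>\<^sub>E {..<p}" "inv (b [^] k) \<otimes> z = lin_comb n d y" by blast
    obtain t x where tx: "t + sum x {..<n} \<le> k" "\<And>i. i < n \<Longrightarrow> [x i + t * v i = y i] (mod p)"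
      using v y(1) unfolding short_cover_def by blast
    \<comment> \<open>The number of padding copies of \<open>b\<close>.\<close>
    define r where "r = k - (t + sum x {..<n})"
    have k: "k = (r + t) + sum x {..<n}" unfolding r_def using tx(1) by simp
    have "b [^] r \<otimes> (b \<otimes> lin_comb n d v) [^] t \<otimes> (\<Otimes>i\<in>{..<n}. (b \<otimes> d i) [^] x i) \<in> iterated_sumset G k ?B"
      unfolding k by (intro iterated_sumset_mult iterated_sumset_pow iterated_sumset_finprod B) auto
    also have "(\<Otimes>i\<in>{..<n}. (b \<otimes> d i) [^] x i) = (\<Otimes>i\<in>{..<n}. b [^] x i \<otimes> d i [^] x i)"
      using b d by (intro finprod_cong) (auto simp: nat_pow_distrib simp_implies_def Pi_iff)
    also have "\<dots> = b [^] sum x {..<n} \<otimes> lin_comb n d x"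
      using b d unfolding lin_comb_def by (subst finprod_multf) (auto simp: finprod_pow_sum Pi_iff)
    also have "(b \<otimes> lin_comb n d v) [^] t = b [^] t \<otimes> lin_comb n d (\<lambda>i. t * v i)"
      using b w d by (simp add: nat_pow_distrib lin_comb_pow)
    also have "b [^] r \<otimes> (b [^] t \<otimes> lin_comb n d (\<lambda>i. t * v i)) \<otimes> (b [^] sum x {..<n} \<otimes> lin_comb n d x)
        = (b [^] r \<otimes> b [^] t \<otimes> b [^] sum x {..<n}) \<otimes> (lin_comb n d x \<otimes> lin_comb n d (\<lambda>i. t * v i))"
      using b lin_comb_closed[OF d] by (simp add: m_ac)
    also have "b [^] r \<otimes> b [^] t \<otimes> b [^] sum x {..<n} = b [^] k"
      using b by (simp add: nat_pow_mult k)
    also have "lin_comb n d x \<otimes> lin_comb n d (\<lambda>i. t * v i) = lin_comb n d y"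
      unfolding lin_comb_add[OF d, symmetric] by (rule lin_comb_cong[OF d exp tx(2)])
    also have "b [^] k \<otimes> lin_comb n d y = z"
      unfolding y(2)[symmetric] using b z by (simp add: m_assoc[symmetric])
    finally show "z \<in> iterated_sumset G k ?B" .
  qed
qed

section \<open>Counting dependent tuples and non-covering sets\<close>

text \<open>Subtracting two equal combinations gives a nontrivial relation. A coefficient that is
  nonzero modulo the prime \<open>p\<close> is invertible, so the relation can be scaled until that
  coefficient is -1 and then solved for \<open>d i\<close>.\<close>

lemma lin_dependent_if_not_inj:
  assumes p: "prime p" and exp: "\<And>g. g \<in> carrier G \<Longrightarrow> g [^] (p :: nat) = \<one>"
    and d: "d \<in> {..<n} \<rightarrow> carrier G"
    and ninj: "\<not> inj_on (lin_comb n d) ({..<n} \<rightarrow>\<^sub>E {..<p})"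
  shows "\<exists>i<n. \<exists>a \<in> ({..<n} - {i}) \<rightarrow>\<^sub>E {..<p}. d i = (\<Otimes>j\<in>{..<n} - {i}. d j [^] a j)"
proof -
  obtain y y' where y: "y \<in> {..<n} \<rightarrow>\<^sub>E {..<p}" "y' \<in> {..<n} \<rightarrow>\<^sub>E {..<p}" "y \<noteq> y'"
    and eq: "lin_comb n d y = lin_comb n d y'"
    using ninj unfolding inj_on_def by blast
  obtain i where i: "i < n" "y i \<noteq> y' i" using y PiE_ext[of y "{..<n}" "\<lambda>_. {..<p}" y'] by auto
  \<comment> \<open>A natural number representing \<open>y j - y' j\<close> modulo
    \<open>p\<close>.\<close>
  define z where "z j = y j + (p - y' j)" for j
  have "lin_comb n d z = lin_comb n d y \<otimes> lin_comb n d (\<lambda>j. p - y' j)"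
    unfolding z_def by (rule lin_comb_add[OF d])
  also have "\<dots> = lin_comb n d (\<lambda>j. y' j + (p - y' j))"
    unfolding eq by (rule lin_comb_add[OF d, symmetric])
  also have "\<dots> = lin_comb n d (\<lambda>j. 0)"
    using y(2) by (intro lin_comb_cong[OF d exp]) (auto simp: unique_euclidean_semiring_class.cong_def PiE_iff less_imp_le)
  also have "\<dots> = \<one>" unfolding lin_comb_def by simp
  finally have z1: "lin_comb n d z = \<one>" .
  have bounds: "y i < p" "y' i < p" using y i by auto
  \<comment> \<open>As \<open>0 < z i < 2 p\<close>, the only possible multiple is \<open>p\<close>
    itself, which would force \<open>y i = y' i\<close>.\<close>
  have "\<not> p dvd z i"
  proof
    assume "p dvd z i"
    then obtain q where q: "z i = p * q" by (auto simp: dvd_def)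
    have "0 < p * q" "p * q < p * 2" using bounds unfolding q[symmetric] z_def by auto
    then have "q = 1" by auto
    then show False using q i bounds unfolding z_def by simp
  qed
  then have "coprime (z i) p" using p by (metis coprime_commute prime_imp_coprime)
  then obtain r where r: "[z i * r = 1] (mod p)" using cong_solve_coprime_nat by auto
  \<comment> \<open>\<open>r\<close> inverts \<open>z i\<close>, and \<open>p - 1\<close> plays the
    role of -1.\<close>
  define a where "a j = (p - 1) * r * z j" for j
  have "lin_comb n d a = lin_comb n d z [^] ((p - 1) * r)"
    unfolding a_def by (rule lin_comb_pow[OF d, symmetric])
  then have a1: "lin_comb n d a = \<one>" using z1 by simp
  have di: "d i \<in> carrier G" using d i by auto
  define R where "R = (\<Otimes>j\<in>{..<n} - {i}. d j [^] a j)"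
  have R: "R \<in> carrier G" unfolding R_def using d by (intro finprod_closed) auto
  have "(\<Otimes>j\<in>insert i ({..<n} - {i}). d j [^] a j) = d i [^] a i \<otimes> R"
    unfolding R_def using d di by (intro finprod_insert) auto
  moreover have "insert i ({..<n} - {i}) = {..<n}" using i by auto
  ultimately have "d i [^] a i \<otimes> R = \<one>" using a1 unfolding lin_comb_def by simp
  moreover have "[a i = p - 1] (mod p)"
  proof -
    have "[(p - 1) * (z i * r) = (p - 1) * 1] (mod p)" using r by (rule cong_scalar_left)
    then show ?thesis unfolding a_def by (simp add: ac_simps)
  qed
  then have "d i [^] a i = d i [^] (p - 1)" using pow_cong_exponent[OF di exp[OF di]] by blast
  ultimately have one: "d i [^] (p - 1) \<otimes> R = \<one>" by simp
  have "d i \<otimes> d i [^] (p - 1) = d i [^] (1 + (p - 1))"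
    using di nat_pow_mult[OF di, of 1 "p - 1"] by simp
  then have "d i \<otimes> d i [^] (p - 1) = \<one>" using exp[OF di] prime_gt_0_nat[OF p] by simp
  then have "d i = R" using one di R by (metis m_assoc nat_pow_closed l_one r_one)
  also have "R = (\<Otimes>j\<in>{..<n} - {i}. d j [^] (\<lambda>j\<in>{..<n} - {i}. a j mod p) j)"
    unfolding R_def using d
    by (intro finprod_cong)
       (auto simp: simp_implies_def Pi_iff unique_euclidean_semiring_class.cong_def
         intro!: pow_cong_exponent[where p=p] exp)
  finally show ?thesis
    using i(1) prime_gt_0_nat[OF p] by (intro exI[of _ i] conjI bexI[of _ "\<lambda>j\<in>{..<n} - {i}. a j mod p"]) auto
qed

text \<open>A dependent tuple is determined by an index \<open>i\<close>, the coefficients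
  expressing \<open>d i\<close>, and the other entries. In a group of order \<open>p^n\<close> this
  is a proportion of at most \<open>n / p\<close> of all tuples.\<close>

lemma card_lin_dependent_le:
  assumes p: "prime p" and exp: "\<And>g. g \<in> carrier G \<Longrightarrow> g [^] (p :: nat) = \<one>"
    and fin: "finite (carrier G)"
  shows "card {d \<in> {..<n} \<rightarrow>\<^sub>E carrier G. \<not> inj_on (lin_comb n d) ({..<n} \<rightarrow>\<^sub>E {..<p})}
    \<le> n * (p ^ (n - 1) * card (carrier G) ^ (n - 1))"
proof -
  define A where "A i = ({..<n} - {i}) \<rightarrow>\<^sub>E {..<p}" for i
  define S where "S i a = {d \<in> {..<n} \<rightarrow>\<^sub>E carrier G. d i = (\<Otimes>j\<in>{..<n} - {i}. d j [^] (a j :: nat))}" for i a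
  have finA: "finite (A i)" for i unfolding A_def by (intro finite_PiE) auto
  have finS: "finite (S i a)" for i a
    unfolding S_def by (rule finite_subset[of _ "{..<n} \<rightarrow>\<^sub>E carrier G"]) (auto intro: finite_PiE fin)
  have card_S: "card (S i a) \<le> card (carrier G) ^ (n - 1)" if i: "i < n" for i a
  proof -
    have "inj_on (\<lambda>d. restrict d ({..<n} - {i})) (S i a)"
    proof (rule inj_onI)
      fix d d' assume d: "d \<in> S i a" and d': "d' \<in> S i a"
        and eq: "restrict d ({..<n} - {i}) = restrict d' ({..<n} - {i})"
      have off: "d j = d' j" if "j \<in> {..<n} - {i}" for j using fun_cong[OF eq, of j] that by simp
      have "(\<Otimes>j\<in>{..<n} - {i}. d j [^] a j) = (\<Otimes>j\<in>{..<n} - {i}. d' j [^] a j)"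
        using d' off unfolding S_def by (intro finprod_cong) (auto simp: simp_implies_def PiE_iff)
      then have "d i = d' i" using d d' unfolding S_def by simp
      then have "d j = d' j" if "j \<in> {..<n}" for j using off that by (cases "j = i") auto
      then show "d = d'" using d d' unfolding S_def
        by (intro PiE_ext[of d "{..<n}" "\<lambda>_. carrier G"]) auto
    qed
    then have "card (S i a) \<le> card (({..<n} - {i}) \<rightarrow>\<^sub>E carrier G)"
    proof (rule card_inj_on_le)
      show "(\<lambda>d. restrict d ({..<n} - {i})) ` S i a \<subseteq> ({..<n} - {i}) \<rightarrow>\<^sub>E carrier G"
      proof (rule image_subsetI)
        fix d assume "d \<in> S i a"
        then have "d \<in> {..<n} \<rightarrow>\<^sub>E carrier G" unfolding S_def by blast
        then show "restrict d ({..<n} - {i}) \<in> ({..<n} - {i}) \<rightarrow>\<^sub>E carrier G" by auto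
      qed
      show "finite (({..<n} - {i}) \<rightarrow>\<^sub>E carrier G)" by (intro finite_PiE) (auto simp: fin)
    qed
    also have "\<dots> = card (carrier G) ^ (n - 1)" using i by (simp add: card_PiE)
    finally show ?thesis .
  qed
  have "{d \<in> {..<n} \<rightarrow>\<^sub>E carrier G. \<not> inj_on (lin_comb n d) ({..<n} \<rightarrow>\<^sub>E {..<p})}
      \<subseteq> (\<Union>i<n. \<Union>a\<in>A i. S i a)" (is "?D \<subseteq> ?U")
  proof
    fix d assume d: "d \<in> ?D"
    then have "d \<in> {..<n} \<rightarrow> carrier G" "\<not> inj_on (lin_comb n d) ({..<n} \<rightarrow>\<^sub>E {..<p})" by auto
    from lin_dependent_if_not_inj[OF p exp this]
    obtain i a where "i < n" "a \<in> A i" "d i = (\<Otimes>j\<in>{..<n} - {i}. d j [^] a j)"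
      unfolding A_def by blast
    then show "d \<in> ?U" using d unfolding S_def by blast
  qed
  then have "card ?D \<le> card ?U" using finA finS by (intro card_mono) auto
  also have "\<dots> \<le> (\<Sum>i<n. card (\<Union>a\<in>A i. S i a))" by (rule card_UN_le) simp
  also have "\<dots> \<le> (\<Sum>i<n. p ^ (n - 1) * card (carrier G) ^ (n - 1))"
  proof (rule sum_mono)
    fix i assume i: "i \<in> {..<n}"
    have "card (\<Union>a\<in>A i. S i a) \<le> (\<Sum>a\<in>A i. card (S i a))" by (rule card_UN_le[OF finA])
    also have "\<dots> \<le> (\<Sum>a\<in>A i. card (carrier G) ^ (n - 1))" using i card_S by (intro sum_mono) auto
    also have "\<dots> = p ^ (n - 1) * card (carrier G) ^ (n - 1)" using i unfolding A_def by (simp add: card_PiE)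
    finally show "card (\<Union>a\<in>A i. S i a) \<le> p ^ (n - 1) * card (carrier G) ^ (n - 1)" .
  qed
  finally show ?thesis by simp
qed

text \<open>Each bad set is the image of a triple \<open>(b, d, w)\<close>, so counting bad triples
  suffices. A triple can be bad because \<open>d\<close> is dependent, with \<open>w\<close>
  arbitrary (first summand), or because \<open>w\<close> has coordinates without the short cover
  property in the basis \<open>d\<close> (second summand).\<close>

lemma card_not_covering_sets_le:
  assumes p: "prime p" and exp: "\<And>g. g \<in> carrier G \<Longrightarrow> g [^] (p :: nat) = \<one>"
    and card_G: "card (carrier G) = p ^ n"
  shows "card {B. B \<subseteq> carrier G \<and> card B = n + 2 \<and> iterated_sumset G k B \<noteq> carrier G}
    \<le> p ^ n * (n * (p ^ (n - 1) * (p ^ n) ^ (n - 1)) * p ^ n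
        + (p ^ n) ^ n * card {v \<in> {..<n} \<rightarrow>\<^sub>E {..<p}. \<not> short_cover p n k v})"
proof -
  define Y where "Y = {..<n} \<rightarrow>\<^sub>E {..<p}"
  define V where "V = {..<n} \<rightarrow>\<^sub>E carrier G"
  define Dep where "Dep = {d \<in> V. \<not> inj_on (lin_comb n d) Y}"
  define N where "N = {v \<in> Y. \<not> short_cover p n k v}"
  define W where "W d = (if d \<in> Dep then carrier G else lin_comb n d ` N)" for d
  define Phi where "Phi = (\<lambda>(b, d, w). insert b (insert (b \<otimes> w) ((\<lambda>i. b \<otimes> d i) ` {..<n})))"
  have fin: "finite (carrier G)" 
    using card_G prime_gt_0_nat[OF p] by (intro card_ge_0_finite) simp
  have finY: "finite Y" unfolding Y_def by (intro finite_PiE) auto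
  have card_Y: "card Y = p ^ n" unfolding Y_def by (simp add: card_PiE)
  have finV: "finite V" unfolding V_def by (intro finite_PiE) (auto simp: fin)
  have card_V: "card V = (p ^ n) ^ n" unfolding V_def by (simp add: card_PiE card_G)
  have finN: "finite N" unfolding N_def using finY by simp
  have finW: "finite (W d)" for d unfolding W_def using fin finN by simp
  \<comment> \<open>An injective map between sets of equal size \<open>p^n\<close> is onto:
    independent tuples are bases.\<close>
  have surj: "lin_comb n d ` Y = carrier G" if "d \<in> V" "d \<notin> Dep" for d
  proof (rule card_subset_eq[OF fin])
    show "lin_comb n d ` Y \<subseteq> carrier G"
      using that lin_comb_closed[of d n] unfolding V_def by (auto simp: PiE_iff)
    show "card (lin_comb n d ` Y) = card (carrier G)"
      using that card_image[of "lin_comb n d" Y] unfolding Dep_def by (simp add: card_Y card_G)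
  qed
  have "{B. B \<subseteq> carrier G \<and> card B = n + 2 \<and> iterated_sumset G k B \<noteq> carrier G}
      \<subseteq> Phi ` (carrier G \<times> Sigma V W)" (is "?Bad \<subseteq> _")
  proof
    fix B assume B: "B \<in> ?Bad"
    then have sub: "B \<subseteq> carrier G" and card_B: "card B = n + 2"
      and bad: "iterated_sumset G k B \<noteq> carrier G"
      by simp_all
    have "finite B" using fin sub by (rule finite_subset[rotated])
    then obtain h where "bij_betw h {0..<card B} B" using ex_bij_betw_nat_finite by blast
    then have h: "h ` {0..<n + 2} = B" unfolding card_B by (rule bij_betw_imp_surj_on)
    have hB: "h i \<in> carrier G" if "i < n + 2" for i using that sub unfolding h[symmetric] by auto
    \<comment> \<open>In an enumeration of \<open>B\<close> by \<open>0, ..., n + 1\<close>,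
      position \<open>n\<close> gives the base point and \<open>n + 1\<close> gives
      \<open>w\<close>, which leaves \<open>0, ..., n - 1\<close> as the indices of
      \<open>d\<close>.\<close>
    define b where "b = h n"
    define d where "d = (\<lambda>i\<in>{..<n}. inv b \<otimes> h i)"
    define w where "w = inv b \<otimes> h (n + 1)"
    have b: "b \<in> carrier G" unfolding b_def by (simp add: hB)
    have d: "d \<in> V" using hB b unfolding d_def V_def by auto
    have w: "w \<in> carrier G" using hB b unfolding w_def by auto
    have cancel: "b \<otimes> (inv b \<otimes> g) = g" if "g \<in> carrier G" for g
      using that b by (simp add: m_assoc[symmetric])
    have "(\<lambda>i. b \<otimes> d i) ` {..<n} = h ` {..<n}"
      using hB unfolding d_def by (intro image_cong) (auto simp: cancel)
    moreover have "b \<otimes> w = h (n + 1)" unfolding w_def by (rule cancel) (simp add: hB)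
    moreover have "{0..<n + 2} = insert n (insert (n + 1) {..<n})" by auto
    ultimately have Phi: "Phi (b, d, w) = B" unfolding Phi_def h[symmetric] by (simp add: b_def)
    have "w \<in> W d"
    proof (cases "d \<in> Dep")
      case True
      then show ?thesis using w unfolding W_def by simp
    next
      case False
      then obtain v where v: "v \<in> Y" "w = lin_comb n d v" using surj[OF d] w by blast
      have "\<not> short_cover p n k v"
      proof
        assume sc: "short_cover p n k v"
        have "d \<in> {..<n} \<rightarrow> carrier G" using d unfolding V_def by auto
        from iterated_sumset_eq_carrier[OF exp b this surj[OF d False, unfolded Y_def] sc]
        have "iterated_sumset G k (Phi (b, d, w)) = carrier G" unfolding Phi_def v(2) by simp
        then show False using bad Phi by simp
      qed
      then show ?thesis using v False unfolding W_def N_def by simp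
    qed
    then show "B \<in> Phi ` (carrier G \<times> Sigma V W)" using Phi b d by blast
  qed
  then have "card ?Bad \<le> card (carrier G \<times> Sigma V W)"
    using fin finV finW by (intro surj_card_le) auto
  also have "\<dots> = p ^ n * (\<Sum>d\<in>V. card (W d))"
    using finV finW by (simp add: card_cartesian_product card_G)
  also have "(\<Sum>d\<in>V. card (W d)) \<le> (\<Sum>d\<in>V. (if d \<in> Dep then p ^ n else 0) + card N)"
    using finN by (intro sum_mono) (auto simp: W_def card_G card_image_le)
  also have "\<dots> = card Dep * p ^ n + (p ^ n) ^ n * card N"
  proof -
    have "V \<inter> Dep = Dep" unfolding Dep_def by auto
    then show ?thesis using finV by (simp add: sum.distrib card_V sum.If_cases)
  qed
  also have "card Dep \<le> n * (p ^ (n - 1) * (p ^ n) ^ (n - 1))"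
    using card_lin_dependent_le[OF p exp fin, of n] unfolding Dep_def V_def Y_def card_G .
  finally show ?thesis unfolding N_def Y_def by simp
qed

end

section \<open>The covering probability\<close>

lemma carrier_Fp_space: "carrier (Fp_space p n) = {..<n} \<rightarrow>\<^sub>E {0..int p - 1}"
  by (simp add: Fp_space_def residue_ring_def)

lemma card_carrier_Fp_space: "card (carrier (Fp_space p n)) = p ^ n"
  by (simp add: carrier_Fp_space card_PiE)

lemma comm_group_Fp_space:
  assumes "1 < p"
  shows "comm_group (Fp_space p n)"
proof -
  interpret residues "int p" "residue_ring (int p)"
    using assms by unfold_locales simp_all
  have grp: "group (Fp_space p n)"
    unfolding Fp_space_def by (intro product_group add.group_axioms)
  show ?thesis
    by (rule group.group_comm_groupI[OF grp])
       (auto simp: Fp_space_def residue_ring_def add.commute intro!: restrict_ext)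
qed

lemma Fp_space_pow:
  assumes "x \<in> carrier (Fp_space p n)"
  shows "x [^]\<^bsub>Fp_space p n\<^esub> (k :: nat) = (\<lambda>i\<in>{..<n}. int k * x i mod int p)"
proof (induction k)
  case 0
  then show ?case by (auto simp: Fp_space_def residue_ring_def nat_pow_def)
next
  case (Suc k)
  then show ?case
    by (auto simp: Fp_space_def residue_ring_def nat_pow_def fun_eq_iff distrib_right mod_simps add.commute)
qed

lemma Fp_space_pow_p:
  assumes "x \<in> carrier (Fp_space p n)"
  shows "x [^]\<^bsub>Fp_space p n\<^esub> p = \<one>\<^bsub>Fp_space p n\<^esub>"
  unfolding Fp_space_pow[OF assms] by (simp add: Fp_space_def residue_ring_def)

section \<open>The quantitative bound and the limit\<close>

text \<open>Divide the count of bad sets by the number of all sets. The latter is at least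
  \<open>(p^n / (n + 2))^(n + 2)\<close>, which is where the factor \<open>(n + 2)^(n + 2)\<close>
  comes from. The two error terms come from dependent tuples and from failing coordinate
  vectors.\<close>

lemma covering_prob_ge:
  assumes p: "prime p" and n: "0 < n" and np: "n + 2 \<le> p" and m: "0 < m" and ms: "m ^ s \<le> p"
    and k: "m ^ Suc s + 2 * n * p \<le> m * k"
  shows "1 - (real n + 2) ^ (n + 2) * (real n / real p + (2 * real m) ^ n * (1 - 1 / real m ^ n) ^ s)
    \<le> measure_pmf.prob (random_point_set p n (n + 2))
        {B. iterated_sumset (Fp_space p n) k B = carrier (Fp_space p n)}"
proof -
  define G where "G = Fp_space p n"
  define Om where "Om = {B. B \<subseteq> carrier G \<and> card B = n + 2}"
  define E where "E = {B. iterated_sumset G k B = carrier G}"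
  define q where "q = real p"
  have p1: "1 < p" using prime_gt_1_nat[OF p] .
  have q: "0 < q" using p1 unfolding q_def by simp
  have card_G: "card (carrier G) = p ^ n" unfolding G_def by (rule card_carrier_Fp_space)
  have fin_G: "finite (carrier G)" unfolding G_def carrier_Fp_space by (intro finite_PiE) auto
  have fin_Om: "finite Om"
    unfolding Om_def by (rule finite_subset[of _ "Pow (carrier G)"]) (auto simp: fin_G)
  have card_Om: "card Om = p ^ n choose (n + 2)"
    unfolding Om_def card_G[symmetric] by (rule n_subsets[OF fin_G])
  have "p ^ 1 \<le> p ^ n" using n p1 by (intro power_increasing) auto
  then have "n + 2 \<le> p ^ n" using np by simp
  then have "(real (p ^ n) / real (n + 2)) ^ (n + 2) \<le> real (card Om)"
    unfolding card_Om by (rule binomial_ge_n_over_k_pow_k)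
  then have Om_ge: "(q ^ n / (real n + 2)) ^ (n + 2) \<le> real (card Om)"
    by (simp only: q_def of_nat_power of_nat_add of_nat_numeral)
  have lower_pos: "0 < (q ^ n / (real n + 2)) ^ (n + 2)" using q by simp
  then have Om_pos: "0 < real (card Om)" using Om_ge by linarith
  then have ne: "Om \<noteq> {}" by auto

  define N where "N = card {v \<in> {..<n} \<rightarrow>\<^sub>E {..<p}. \<not> short_cover p n k v}"
  \<comment> \<open>Since \<open>m ^ s \<le> p\<close>, the extra 1 at most doubles the window; this
    produces the factor \<open>2^n\<close>.\<close>
  have "real (p div m ^ s + 1) \<le> 2 * (q / real m ^ s)"
  proof -
    have "real (p div m ^ s) \<le> q / real m ^ s"
      using of_nat_div_le_of_nat[of p "m ^ s"] unfolding q_def by simp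
    moreover have "1 \<le> q / real m ^ s"
      using m ms unfolding q_def by (simp add: le_divide_eq flip: of_nat_power)
    ultimately show ?thesis by simp
  qed
  then have box: "real (p div m ^ s + 1) ^ n \<le> (2 * (q / real m ^ s)) ^ n"
    by (intro power_mono) auto
  have "real N \<le> real (m ^ n * ((m ^ n - 1) ^ s * (p div m ^ s + 1) ^ n))"
    unfolding N_def of_nat_le_iff using p1 by (intro card_not_short_cover_le m k) auto
  also have "\<dots> = real m ^ n * ((real m ^ n - 1) ^ s * real (p div m ^ s + 1) ^ n)"
    using m by (simp add: of_nat_diff)
  also have "\<dots> \<le> real m ^ n * ((real m ^ n - 1) ^ s * (2 * (q / real m ^ s)) ^ n)"
    using m by (intro mult_left_mono box) auto
  also have "\<dots> = q ^ n * ((2 * real m) ^ n * (1 - 1 / real m ^ n) ^ s)"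
  proof -
    have "1 - 1 / real m ^ n = (real m ^ n - 1) / real m ^ n" using m by (simp add: field_simps)
    then show ?thesis
      by (simp add: power_mult_distrib power_divide power_mult[symmetric] mult.commute)
  qed
  finally have N_le: "real N \<le> q ^ n * ((2 * real m) ^ n * (1 - 1 / real m ^ n) ^ s)" .

  have "card (Om - E) \<le> p ^ n * (n * (p ^ (n - 1) * (p ^ n) ^ (n - 1)) * p ^ n + (p ^ n) ^ n * N)"
  proof -
    have "Om - E = {B. B \<subseteq> carrier G \<and> card B = n + 2 \<and> iterated_sumset G k B \<noteq> carrier G}"
      unfolding Om_def E_def by auto
    then show ?thesis
      using comm_group.card_not_covering_sets_le[OF comm_group_Fp_space[OF p1] p, of n n k]
        card_G Fp_space_pow_p
      unfolding G_def N_def by simp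
  qed
  then have "real (card (Om - E))
      \<le> real (p ^ n * (n * (p ^ (n - 1) * (p ^ n) ^ (n - 1)) * p ^ n + (p ^ n) ^ n * N))"
    by (simp only: of_nat_le_iff)
  also have "\<dots> = q ^ n * (real n * (q ^ (n - 1) * (q ^ n) ^ (n - 1)) * q ^ n + (q ^ n) ^ n * real N)"
    by (simp add: q_def)
  \<comment> \<open>The saving of a factor \<open>q\<close> over all tuples is what makes dependence
    rare.\<close>
  also have "q ^ (n - 1) * (q ^ n) ^ (n - 1) = (q ^ n) ^ n / q"
  proof -
    have "q ^ n = q * q ^ (n - 1)" "(q ^ n) ^ n = q ^ n * (q ^ n) ^ (n - 1)"
      using n by (simp_all add: power_eq_if)
    then show ?thesis using q by (simp add: field_simps)
  qed
  also have "q ^ n * (real n * ((q ^ n) ^ n / q) * q ^ n + (q ^ n) ^ n * real N)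
      \<le> q ^ n * (real n * ((q ^ n) ^ n / q) * q ^ n
          + (q ^ n) ^ n * (q ^ n * ((2 * real m) ^ n * (1 - 1 / real m ^ n) ^ s)))"
    using q N_le by (intro mult_left_mono add_left_mono) auto
  also have "\<dots> = (q ^ n) ^ (n + 2) * (real n / q + (2 * real m) ^ n * (1 - 1 / real m ^ n) ^ s)"
    by (simp add: algebra_simps power_add power2_eq_square)
  also have "\<dots> = (q ^ n / (real n + 2)) ^ (n + 2)
      * ((real n + 2) ^ (n + 2) * (real n / q + (2 * real m) ^ n * (1 - 1 / real m ^ n) ^ s))"
  proof -
    have "(q ^ n / (real n + 2)) ^ (n + 2) * (real n + 2) ^ (n + 2) = (q ^ n) ^ (n + 2)"
      unfolding power_mult_distrib[symmetric] by simp
    then show ?thesis by (simp only: mult.assoc[symmetric])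
  qed
  also have "\<dots> \<le> real (card Om)
      * ((real n + 2) ^ (n + 2) * (real n / q + (2 * real m) ^ n * (1 - 1 / real m ^ n) ^ s))"
  proof (rule mult_right_mono[OF Om_ge])
    have "0 \<le> 1 - 1 / real m ^ n" using m by simp
    then show "0 \<le> (real n + 2) ^ (n + 2) * (real n / q + (2 * real m) ^ n * (1 - 1 / real m ^ n) ^ s)"
      using q by simp
  qed
  finally have bad: "real (card (Om - E)) / real (card Om)
      \<le> (real n + 2) ^ (n + 2) * (real n / q + (2 * real m) ^ n * (1 - 1 / real m ^ n) ^ s)"
    using Om_pos by (simp add: divide_le_eq mult.commute)
  have "card Om = card (Om \<inter> E) + card (Om - E)"
    using fin_Om by (rule card_Int_Diff)
  then have "real (card (Om \<inter> E)) / real (card Om) = 1 - real (card (Om - E)) / real (card Om)"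
    using Om_pos by (simp add: field_simps)
  moreover have "measure_pmf.prob (random_point_set p n (n + 2)) E = real (card (Om \<inter> E)) / real (card Om)"
    unfolding random_point_set_def G_def[symmetric] Om_def[symmetric]
    by (rule measure_pmf_of_set[OF ne fin_Om])
  ultimately show ?thesis using bad unfolding E_def G_def q_def by simp
qed

theorem theorem1p4:
  fixes c :: real and n :: nat
  assumes "0 < c" and "c < 1" and "0 < n"
  shows "((\<lambda>p. measure_pmf.prob (random_point_set p n (n + 2))
            {B. iterated_sumset (Fp_space p n) (nat \<lceil>c * real p\<rceil>) B = carrier (Fp_space p n)})
          \<longlongrightarrow> 1) (inf sequentially (principal {p :: nat. prime p}))"
proof (rule tendstoI)
  fix \<epsilon> :: real assume \<epsilon>: "0 < \<epsilon>"
  \<comment> \<open>With \<open>m \<ge> 4 n / c\<close>, the coordinate corrections, in total below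
    \<open>2 n p / m\<close>, use at most half of the budget \<open>c p\<close>.\<close>
  define m where "m = nat \<lceil>4 * real n / c\<rceil>"
  have "4 * real n / c \<le> real m" unfolding m_def by (rule real_nat_ceiling_ge)
  then have mc: "4 * real n \<le> c * real m" using assms by (simp add: divide_le_eq mult.commute)
  have m: "0 < m" using mc assms by (cases "m = 0") auto
  define K where "K = (real n + 2) ^ (n + 2)"
  have "norm (1 - 1 / real m ^ n) < 1"
  proof -
    have "0 < 1 / real m ^ n" "1 / real m ^ n \<le> 1" using m by auto
    then show ?thesis by simp
  qed
  then have "(\<lambda>s. K * ((2 * real m) ^ n * (1 - 1 / real m ^ n) ^ s)) \<longlonglongrightarrow> K * ((2 * real m) ^ n * 0)"
    by (intro tendsto_intros LIMSEQ_power_zero)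
  then have "\<forall>\<^sub>F s in sequentially. K * ((2 * real m) ^ n * (1 - 1 / real m ^ n) ^ s) < \<epsilon> / 2"
    using \<epsilon> by (intro order_tendstoD(2)) auto
  \<comment> \<open>\<open>s\<close> depends only on \<open>c\<close>, \<open>n\<close> and
    \<open>\<epsilon>\<close>, so \<open>m ^ s\<close> stays fixed while \<open>p\<close>
    grows.\<close>
  then obtain s where s: "K * ((2 * real m) ^ n * (1 - 1 / real m ^ n) ^ s) < \<epsilon> / 2"
    using eventually_sequentially by auto
  have "(\<lambda>p. K * (real n / real p)) \<longlonglongrightarrow> K * 0"
    by (intro tendsto_intros lim_const_over_n)
  then have "\<forall>\<^sub>F p in sequentially. K * (real n / real p) < \<epsilon> / 2"
    using \<epsilon> by (intro order_tendstoD(2)) auto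
  moreover have "\<forall>\<^sub>F p in sequentially. n + 2 \<le> p" by (rule eventually_ge_at_top)
  moreover have "\<forall>\<^sub>F p in sequentially. m ^ s \<le> p" by (rule eventually_ge_at_top)
  \<comment> \<open>This threshold gives \<open>m ^ s \<le> c p / 2\<close>, so the multiple of
    \<open>v\<close> fits into the other half of the budget.\<close>
  moreover have "\<forall>\<^sub>F p in sequentially. nat \<lceil>2 * real m ^ s / c\<rceil> \<le> p" by (rule eventually_ge_at_top)
  ultimately have "\<forall>\<^sub>F p in sequentially. prime p \<longrightarrow>
      dist (measure_pmf.prob (random_point_set p n (n + 2))
        {B. iterated_sumset (Fp_space p n) (nat \<lceil>c * real p\<rceil>) B = carrier (Fp_space p n)}) 1 < \<epsilon>"
  proof eventually_elim
    case (elim p)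
    show ?case
    proof
      assume p: "prime p"
      define k where "k = nat \<lceil>c * real p\<rceil>"
      define P where "P = measure_pmf.prob (random_point_set p n (n + 2))
        {B. iterated_sumset (Fp_space p n) k B = carrier (Fp_space p n)}"
      have "2 * real m ^ s / c \<le> real p" using elim(4) by linarith
      then have "2 * real m ^ s \<le> c * real p" using assms by (simp add: divide_le_eq mult.commute)
      then have "real m * (2 * real m ^ s) \<le> real m * (c * real p)" by (intro mult_left_mono) auto
      moreover have "4 * real n * real p \<le> c * real m * real p" using mc by (intro mult_right_mono) auto
      moreover have "real m * (c * real p) \<le> real m * real k"
        unfolding k_def by (intro mult_left_mono real_nat_ceiling_ge) auto
      ultimately have "real m * real m ^ s + 2 * real n * real p \<le> real m * real k"
        by (simp add: algebra_simps)
      then have "real (m ^ Suc s + 2 * n * p) \<le> real (m * k)" by simp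
      then have "m ^ Suc s + 2 * n * p \<le> m * k" by (simp only: of_nat_le_iff)
      from covering_prob_ge[OF p assms(3) elim(2) m elim(3) this]
      have "1 - K * (real n / real p + (2 * real m) ^ n * (1 - 1 / real m ^ n) ^ s) \<le> P"
        unfolding K_def P_def .
      then have "1 - \<epsilon> < P" using s elim(1) by (simp add: distrib_left)
      moreover have "P \<le> 1" unfolding P_def by simp
      ultimately show "dist (measure_pmf.prob (random_point_set p n (n + 2))
          {B. iterated_sumset (Fp_space p n) (nat \<lceil>c * real p\<rceil>) B = carrier (Fp_space p n)}) 1 < \<epsilon>"
        unfolding P_def k_def dist_real_def by simp
    qed
  qed
  then show "\<forall>\<^sub>F p in inf sequentially (principal {p. prime p}).
      dist (measure_pmf.prob (random_point_set p n (n + 2))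
        {B. iterated_sumset (Fp_space p n) (nat \<lceil>c * real p\<rceil>) B = carrier (Fp_space p n)}) 1 < \<epsilon>"
    by (simp add: eventually_inf_principal)
qed

end
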